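(* Every finite simple graph $G$ can be decomposed into additive prime factors: $G=p_1+\cdots+p_n$, where the $p_i$ are additive prime graphs.
   Context: The (Zykov) join $H+K$ of two graphs is the disjoint union of $H$ and $K$ with all edges between a vertex of $H$ and a vertex of $K$ added; the empty graph is the zero element $0$. A graph $G$ is an additive prime graph if it can not be written as $G=H+K$ with both $H,K$ different from the zero element. Equality means graph isomorphism. *)

theory Defs
  imports "Graph_Theory.Graph_Theory"
begin

text \<open>
  A finite simple graph is a \<^locale>\<open>pair_graph\<close>: a finite, symmetric, loop-free set of arcs on a
  finite vertex set (an undirected edge is a pair of opposite arcs); the empty graph is included.
\<close>

abbreviation graph_iso :: "'a pair_pre_digraph \<Rightarrow> 'b pair_pre_digraph \<Rightarrow> bool" (infix "\<cong>\<^sub>g" 50) where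
  "G \<cong>\<^sub>g H \<equiv> digraph_iso (with_proj G) (with_proj H)"

definition zero_graph :: "'a pair_pre_digraph" where
  "zero_graph = \<lparr> pverts = {}, parcs = {} \<rparr>"

definition zykov_join ::
    "'a pair_pre_digraph \<Rightarrow> 'b pair_pre_digraph \<Rightarrow> ('a + 'b) pair_pre_digraph" (infixr "+\<^sub>g" 65) where
  "H +\<^sub>g K =
    \<lparr> pverts = pverts H <+> pverts K,
      parcs = map_prod Inl Inl ` parcs H \<union> map_prod Inr Inr ` parcs K
        \<union> (Inl ` pverts H) \<times> (Inr ` pverts K) \<union> (Inr ` pverts K) \<times> (Inl ` pverts H) \<rparr>"

text \<open>
  HOL cannot quantify over vertex types inside a definition, so the summands range over graphs on
  the vertex type of \<open>G\<close>. Nothing is lost: summands of \<open>G\<close> are isomorphic to induced subgraphs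
  of \<open>G\<close>, and \<open>additive_prime_any_type\<close> below removes the restriction.
  The condition is taken literally: the empty graph satisfies it.
\<close>

definition additive_prime :: "'a pair_pre_digraph \<Rightarrow> bool" where
  "additive_prime G \<longleftrightarrow> pair_graph G \<and>
    \<not> (\<exists>(H :: 'a pair_pre_digraph) (K :: 'a pair_pre_digraph).
          pair_graph H \<and> pair_graph K \<and> H \<noteq> zero_graph \<and> K \<noteq> zero_graph \<and> G \<cong>\<^sub>g H +\<^sub>g K)"

definition relabel :: "('a \<Rightarrow> 'b) \<Rightarrow> 'a pair_pre_digraph \<Rightarrow> 'b pair_pre_digraph" where
  "relabel f G = \<lparr> pverts = f ` pverts G, parcs = map_prod f f ` parcs G \<rparr>"

text \<open>
  The iterated join \<open>p\<^sub>1 + (p\<^sub>2 + (\<dots> + (p\<^sub>n + 0)))\<close>. The vertex type of a binary join grows with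
  each summand, so after each step the vertices are renamed injectively: vertex \<open>v\<close> of the summand
  at position \<open>i\<close> (counted from 0) becomes \<open>(i, v)\<close>.
\<close>

primrec join_list :: "'a pair_pre_digraph list \<Rightarrow> (nat \<times> 'a) pair_pre_digraph" where
  "join_list [] = zero_graph"
| "join_list (H # Hs) =
     relabel (case_sum (\<lambda>v. (0, v)) (\<lambda>(i, v). (Suc i, v))) (H +\<^sub>g join_list Hs)"

lemma graph_isoI:
  assumes "pair_graph G" "inj_on f (pverts G)" "H = relabel f G"
  shows "G \<cong>\<^sub>g H"
proof -
  interpret pair_graph G by fact
  let ?h = "\<lparr> iso_verts = f, iso_arcs = map_prod f f, iso_head = snd, iso_tail = fst \<rparr>"
  have "inj_on (map_prod f f) (pverts G \<times> pverts G)"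
    using assms(2) by (auto simp: inj_on_def)
  moreover have "parcs G \<subseteq> pverts G \<times> pverts G"
    by (auto dest: in_arcsD1 in_arcsD2)
  ultimately have "inj_on (map_prod f f) (parcs G)"
    by (rule inj_on_subset)
  moreover have "wf_digraph (with_proj G)" by (rule wf_digraph)
  ultimately have "pre_digraph.digraph_isomorphism (with_proj G) ?h"
    using assms(2) by (auto simp: pre_digraph.digraph_isomorphism_def)
  moreover have "with_proj H = app_iso ?h (with_proj G)"
    by (simp add: assms(3) relabel_def with_proj_def app_iso_def)
  ultimately show ?thesis unfolding digraph_iso_def by blast
qed

lemma graph_isoE:
  assumes "pair_graph G" "G \<cong>\<^sub>g H"
  obtains f where "inj_on f (pverts G)" "H = relabel f G"
proof -
  from assms(2) obtain h where h: "pre_digraph.digraph_isomorphism (with_proj G) h"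
    and H: "with_proj H = app_iso h (with_proj G)" unfolding digraph_iso_def by blast
  let ?f = "iso_verts h"
  have t: "iso_tail h = fst" "iso_head h = snd"
    using arg_cong[OF H, of tail] arg_cong[OF H, of head] by simp_all
  have a: "iso_arcs h e = map_prod ?f ?f e" if "e \<in> parcs G" for e
    using h that t by (cases e) (auto simp: pre_digraph.digraph_isomorphism_def prod_eq_iff)
  have "pverts H = ?f ` pverts G" using arg_cong[OF H, of verts] by simp
  moreover have "parcs H = map_prod ?f ?f ` parcs G"
    using arg_cong[OF H, of arcs] a by simp
  ultimately have "H = relabel ?f G" by (simp add: relabel_def)
  moreover have "inj_on ?f (pverts G)"
    using h by (simp add: pre_digraph.digraph_isomorphism_def)
  ultimately show ?thesis using that by blast
qed

lemma pair_graph_zero [simp]: "pair_graph zero_graph"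
  by unfold_locales (auto simp: zero_graph_def symmetric_def sym_def)

lemma pair_graph_relabel:
  assumes "pair_graph G" "inj_on f (pverts G)"
  shows "pair_graph (relabel f G)"
proof -
  interpret pair_graph G by fact
  have "f x \<noteq> f y" if "(x, y) \<in> parcs G" for x y
    using that assms(2) by (metis in_arcsD1 in_arcsD2 no_loops' inj_onD)
  then show ?thesis
    using pair_finite_verts pair_finite_arcs
    by unfold_locales
      (auto simp: relabel_def symmetric_def sym_def
         dest: in_arcsD1 in_arcsD2 arcs_symmetric intro: rev_image_eqI)
qed

lemma pair_graph_join:
  assumes "pair_graph H" "pair_graph K"
  shows "pair_graph (H +\<^sub>g K)"
proof -
  interpret H: pair_graph H by fact
  interpret K: pair_graph K by fact
  show ?thesis
    using H.pair_finite_verts K.pair_finite_verts H.pair_finite_arcs K.pair_finite_arcs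
    by unfold_locales
      (auto simp: zykov_join_def symmetric_def sym_def
         dest: H.in_arcsD1 H.in_arcsD2 K.in_arcsD1 K.in_arcsD2 H.no_loops' K.no_loops'
           H.arcs_symmetric K.arcs_symmetric intro: rev_image_eqI)
qed

lemma inj_join_list_rename: "inj (case_sum (\<lambda>v. (0, v)) (\<lambda>(i, v). (Suc i, v)))"
  by (auto simp: inj_def split: sum.splits)

lemma pair_graph_join_list:
  "(\<And>p. p \<in> set ps \<Longrightarrow> pair_graph p) \<Longrightarrow> pair_graph (join_list ps)"
  by (induction ps)
    (auto intro!: pair_graph_relabel pair_graph_join inj_on_subset[OF inj_join_list_rename])

lemma join_list_Cons_iso:
  assumes "\<And>q. q \<in> set (p # ps) \<Longrightarrow> pair_graph q"
  shows "p +\<^sub>g join_list ps \<cong>\<^sub>g join_list (p # ps)"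
proof (rule graph_isoI)
  show "pair_graph (p +\<^sub>g join_list ps)"
    using assms by (simp add: pair_graph_join pair_graph_join_list)
  show "inj_on (case_sum (\<lambda>v. (0, v)) (\<lambda>(i, v). (Suc i, v))) (pverts (p +\<^sub>g join_list ps))"
    by (rule inj_on_subset[OF inj_join_list_rename subset_UNIV])
qed simp

lemma join_list_single_iso:
  assumes "pair_graph p"
  shows "p \<cong>\<^sub>g join_list [p]"
proof (rule graph_isoI)
  show "inj_on (\<lambda>v. (0, v)) (pverts p)" by (simp add: inj_on_def)
  show "join_list [p] = relabel (\<lambda>v. (0, v)) p"
    by (simp add: relabel_def zykov_join_def zero_graph_def Plus_def image_image
        map_prod_def case_prod_unfold)
qed fact

lemma relabel_relabel: "relabel f (relabel g G) = relabel (f \<circ> g) G"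
  by (simp add: relabel_def image_image map_prod_def case_prod_unfold)

lemma map_prod_Times: "map_prod f g ` (A \<times> B) = (f ` A) \<times> (g ` B)"
  by (auto intro: rev_image_eqI)

lemma relabel_join:
  "relabel (map_sum f g) (H +\<^sub>g K) = relabel f H +\<^sub>g relabel g K"
  by (simp add: relabel_def zykov_join_def Plus_def image_Un image_image map_prod_Times
      prod.map_comp comp_def)

lemma additive_prime_any_type:
  fixes G :: "'a pair_pre_digraph" and H :: "'b pair_pre_digraph" and K :: "'c pair_pre_digraph"
  assumes "additive_prime G" "pair_graph H" "pair_graph K" "G \<cong>\<^sub>g H +\<^sub>g K"
  shows "H = zero_graph \<or> K = zero_graph"
proof (rule ccontr)
  assume nz: "\<not> (H = zero_graph \<or> K = zero_graph)"
  have G: "pair_graph G" using assms(1) by (simp add: additive_prime_def)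
  obtain f where f: "inj_on f (pverts G)" and HK: "H +\<^sub>g K = relabel f G"
    using graph_isoE[OF G assms(4)] .
  define g where "g = inv_into (pverts G) f"
  have "pverts (H +\<^sub>g K) = f ` pverts G" by (simp add: HK relabel_def)
  then have g: "inj_on g (pverts H <+> pverts K)"
    by (simp add: g_def zykov_join_def inj_on_inv_into)
  have gl: "inj_on (g \<circ> Inl) (pverts H)" and gr: "inj_on (g \<circ> Inr) (pverts K)"
    using g by (auto intro!: comp_inj_on inj_on_subset[OF g])
  let ?H = "relabel (g \<circ> Inl) H" and ?K = "relabel (g \<circ> Inr) K"
  let ?m = "map_sum (g \<circ> Inl) (g \<circ> Inr)"
  have "inj_on ?m (pverts H <+> pverts K)"
    by (rule inj_onI) (use inj_onD[OF gl] inj_onD[OF gr] in fastforce)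
  then have "inj_on ?m (f ` pverts G)"
    using \<open>pverts (H +\<^sub>g K) = f ` pverts G\<close> by (simp add: zykov_join_def)
  then have "G \<cong>\<^sub>g ?H +\<^sub>g ?K"
    using f by (intro graph_isoI[OF G comp_inj_on])
      (simp_all add: HK relabel_relabel flip: relabel_join)
  moreover have "?H \<noteq> zero_graph" "?K \<noteq> zero_graph"
    using nz by (auto simp: relabel_def zero_graph_def)
  moreover have "pair_graph ?H" "pair_graph ?K"
    using assms(2,3) gl gr by (simp_all add: pair_graph_relabel)
  ultimately show False
    using assms(1) by (auto simp: additive_prime_def)
qed

end

theory Submission
  imports Defs
begin

text \<open>Strong induction on the number of vertices. A prime graph is its own decomposition.
  Otherwise \<open>G\<close> is a join of two nonzero graphs \<open>H\<close> and \<open>K\<close>;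
  vertex counts add under the join and a nonzero graph has a vertex, so both summands are strictly
  smaller and decompose by induction. Concatenating their lists of primes decomposes
  \<open>G\<close>: the join respects isomorphism (\<open>graph_iso_join\<close>), and
  \<open>join_list\<close> turns concatenation into a join (\<open>join_list_append_iso\<close>),
  because up to isomorphism the join is associative with zero as left unit.\<close>

lemma pair_graph_nonzero_verts:
  assumes "pair_graph G" "G \<noteq> zero_graph"
  shows "pverts G \<noteq> {}"
proof
  assume "pverts G = {}"
  interpret pair_graph G by fact
  have "parcs G = {}"
    using \<open>pverts G = {}\<close> by (auto dest: in_arcsD1)
  with \<open>pverts G = {}\<close> have "G = zero_graph"
    by (simp add: zero_graph_def)
  with assms(2) show False by contradiction
qed

lemma graph_iso_refl:
  assumes "pair_graph G"
  shows "G \<cong>\<^sub>g G"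
  by (rule graph_isoI[OF assms, of id]) (simp_all add: relabel_def map_prod.id)

lemma graph_iso_sym:
  assumes "pair_graph G" "G \<cong>\<^sub>g H"
  shows "H \<cong>\<^sub>g G"
proof -
  interpret pair_graph G by fact
  show ?thesis
    by (rule digraph_iso_swap[OF wf_digraph assms(2)])
qed

lemma graph_iso_card_verts:
  assumes "pair_graph G" "G \<cong>\<^sub>g H"
  shows "card (pverts H) = card (pverts G)"
proof -
  obtain f where "inj_on f (pverts G)" "H = relabel f G"
    using graph_isoE[OF assms] .
  then show ?thesis by (simp add: relabel_def card_image)
qed

text \<open>Relabelling commutes with the join, so injections on the two vertex sets combine into
  \<open>map_sum f g\<close> on the disjoint union.\<close>

lemma graph_iso_join:
  assumes "pair_graph H" "pair_graph K" "H \<cong>\<^sub>g H'" "K \<cong>\<^sub>g K'"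
  shows "H +\<^sub>g K \<cong>\<^sub>g H' +\<^sub>g K'"
proof -
  obtain f where f: "inj_on f (pverts H)" "H' = relabel f H"
    using graph_isoE[OF assms(1,3)] .
  obtain g where g: "inj_on g (pverts K)" "K' = relabel g K"
    using graph_isoE[OF assms(2,4)] .
  have "inj_on (map_sum f g) (pverts H <+> pverts K)"
    by (rule inj_onI) (use inj_onD[OF f(1)] inj_onD[OF g(1)] in fastforce)
  then have "inj_on (map_sum f g) (pverts (H +\<^sub>g K))"
    by (simp add: zykov_join_def)
  then show ?thesis
    by (rule graph_isoI[OF pair_graph_join[OF assms(1,2)]])
      (simp add: f(2) g(2) relabel_join)
qed

lemma join_zero_left_iso:
  assumes "pair_graph K"
  shows "zero_graph +\<^sub>g K \<cong>\<^sub>g K"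
proof (rule graph_isoI)
  show "pair_graph (zero_graph +\<^sub>g K)"
    by (rule pair_graph_join[OF pair_graph_zero assms])
  \<comment> \<open>The left summand has no vertices, so the value \<open>undefined\<close> is never
    taken on an actual vertex.\<close>
  show "inj_on (case_sum undefined id) (pverts (zero_graph +\<^sub>g K))"
    by (auto simp: zykov_join_def zero_graph_def inj_on_def)
  show "K = relabel (case_sum undefined id) (zero_graph +\<^sub>g K)"
    by (simp add: relabel_def zykov_join_def zero_graph_def Plus_def image_image
        map_prod_def case_prod_unfold)
qed

text \<open>Under either bracketing, two vertices from different summands are always adjacent, so
  the canonical bijection between the nested sum types preserves arcs in both directions.\<close>

lemma join_assoc_iso:
  assumes "pair_graph A" "pair_graph B" "pair_graph C"
  shows "(A +\<^sub>g B) +\<^sub>g C \<cong>\<^sub>g A +\<^sub>g (B +\<^sub>g C)"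
proof (rule graph_isoI)
  let ?f = "case_sum (case_sum Inl (Inr \<circ> Inl)) (Inr \<circ> Inr)"
  show "pair_graph ((A +\<^sub>g B) +\<^sub>g C)"
    using assms by (simp add: pair_graph_join)
  show "inj_on ?f (pverts ((A +\<^sub>g B) +\<^sub>g C))"
    by (auto simp: inj_on_def split: sum.splits)
  show "A +\<^sub>g (B +\<^sub>g C) = relabel ?f ((A +\<^sub>g B) +\<^sub>g C)"
    by (simp add: relabel_def zykov_join_def Plus_def image_Un image_image map_prod_Times
        prod.map_comp comp_def Sigma_Un_distrib1 Sigma_Un_distrib2 Un_assoc) blast
qed

text \<open>Since \<open>join_list\<close> nests to the right, the head \<open>p\<close> is split
  off, moved outside by associativity, and reattached after the induction hypothesis has merged the
  tails.\<close>

lemma join_list_append_iso: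
  assumes "\<And>p. p \<in> set (ps @ qs) \<Longrightarrow> pair_graph p"
  shows "join_list ps +\<^sub>g join_list qs \<cong>\<^sub>g join_list (ps @ qs)"
  using assms
proof (induction ps)
  case Nil
  then show ?case
    by (simp add: join_zero_left_iso pair_graph_join_list)
next
  case (Cons p ps)
  let ?P = "join_list ps" and ?Q = "join_list qs"
  have prems: "pair_graph p" "pair_graph ?P" "pair_graph ?Q"
    using Cons.prems by (auto intro!: pair_graph_join_list)
  have "join_list (p # ps) \<cong>\<^sub>g p +\<^sub>g ?P"
    using Cons.prems
    by (intro graph_iso_sym[OF pair_graph_join[OF prems(1,2)]] join_list_Cons_iso) auto
  moreover have "pair_graph (join_list (p # ps))"
    using Cons.prems by (intro pair_graph_join_list) auto
  ultimately have "join_list (p # ps) +\<^sub>g ?Q \<cong>\<^sub>g (p +\<^sub>g ?P) +\<^sub>g ?Q"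
    using graph_iso_join graph_iso_refl prems(3) by blast
  also have "(p +\<^sub>g ?P) +\<^sub>g ?Q \<cong>\<^sub>g p +\<^sub>g (?P +\<^sub>g ?Q)"
    by (rule join_assoc_iso[OF prems])
  also have "p +\<^sub>g (?P +\<^sub>g ?Q) \<cong>\<^sub>g p +\<^sub>g join_list (ps @ qs)"
    using Cons
    by (intro graph_iso_join[OF prems(1) pair_graph_join[OF prems(2,3)] graph_iso_refl[OF prems(1)]])
      auto
  also have "p +\<^sub>g join_list (ps @ qs) \<cong>\<^sub>g join_list ((p # ps) @ qs)"
    using join_list_Cons_iso[of p "ps @ qs"] Cons.prems by simp
  finally show ?case .
qed

theorem lemma10:
  fixes G :: "'a pair_pre_digraph"
  assumes "pair_graph G"
  shows "\<exists>ps :: 'a pair_pre_digraph list.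
           ps \<noteq> [] \<and> (\<forall>p \<in> set ps. additive_prime p) \<and> G \<cong>\<^sub>g join_list ps"
  using assms
proof (induction "card (pverts G)" arbitrary: G rule: less_induct)
  case less
  show ?case
  proof (cases "additive_prime G")
    \<comment> \<open>This case includes the empty graph, which is prime in the literal sense; hence
      the induction has no separate base case and the list is never empty.\<close>
    case True
    then show ?thesis
      by (intro exI[of _ "[G]"] conjI join_list_single_iso[OF less.prems]) simp_all
  next
    case False
    \<comment> \<open>The summands live on the vertex type of \<open>G\<close>, so the induction
      hypothesis, fixed at that type, applies to them.\<close>
    then obtain H K :: "'a pair_pre_digraph" where
      HK: "pair_graph H" "pair_graph K" "H \<noteq> zero_graph" "K \<noteq> zero_graph"
      and iso: "G \<cong>\<^sub>g H +\<^sub>g K"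
      using less.prems by (auto simp: additive_prime_def)
    interpret H: pair_graph H by fact
    interpret K: pair_graph K by fact
    note fin = H.pair_finite_verts K.pair_finite_verts
    have "card (pverts G) = card (pverts H) + card (pverts K)"
      using graph_iso_card_verts[OF less.prems iso] fin
      by (simp add: zykov_join_def card_Plus)
    \<comment> \<open>Each summand is smaller than \<open>G\<close> because the other one
      contributes a vertex.\<close>
    moreover have "card (pverts H) > 0" "card (pverts K) > 0"
      using fin HK by (simp_all add: card_gt_0_iff pair_graph_nonzero_verts)
    ultimately have "card (pverts H) < card (pverts G)" "card (pverts K) < card (pverts G)"
      by simp_all
    then obtain ps qs :: "'a pair_pre_digraph list" where
      ps: "ps \<noteq> []" "\<forall>p \<in> set ps. additive_prime p" "H \<cong>\<^sub>g join_list ps" and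
      qs: "\<forall>p \<in> set qs. additive_prime p" "K \<cong>\<^sub>g join_list qs"
      using less.hyps HK(1,2) by meson
    note iso
    also have "H +\<^sub>g K \<cong>\<^sub>g join_list ps +\<^sub>g join_list qs"
      by (rule graph_iso_join[OF HK(1,2) ps(3) qs(2)])
    also have "join_list ps +\<^sub>g join_list qs \<cong>\<^sub>g join_list (ps @ qs)"
      using ps(2) qs(1) by (intro join_list_append_iso) (auto simp: additive_prime_def)
    finally have "G \<cong>\<^sub>g join_list (ps @ qs)" .
    then show ?thesis
      using ps(1,2) qs(1) by (intro exI[of _ "ps @ qs"]) auto
  qed
qed

end
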